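(* Let $\nu$ be a multiplicative arithmetic function whose support has positive asymptotic density. Let $f$ and $g$ be arithmetic functions with $g = f * \nu$, and suppose $f$ is not identically zero. If $\mathrm{supp}(f)$ is thin, then $\mathrm{supp}(g)$ possesses a positive asymptotic density.
   Context: An arithmetic function is a function $\mathbb{N}\to\mathbb{C}$, where $\mathbb{N}$ is the set of positive integers. The Dirichlet convolution is $(f*g)(n)=\sum_{d\mid n} f(d)\,g(n/d)$. The support $\mathrm{supp}(h)$ of an arithmetic function $h$ is the set of $n\in\mathbb{N}$ with $h(n)\neq 0$. A set $\mathcal{A}\subseteq\mathbb{N}$ is thin if $\sum_{a\in\mathcal{A}}1/a<\infty$. The asymptotic density of $\mathcal{A}$ is $\lim_{x\to\infty}\#(\mathcal{A}\cap[1,x])/x$, when it exists; "possesses a positive asymptotic density" means this limit exists and is positive. *)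

theory Defs
  imports "HOL-Analysis.Analysis"
begin

text \<open>
  Arithmetic functions are modelled as functions of type \<^typ>\<open>nat \<Rightarrow> complex\<close>; only their values
  at positive arguments are meaningful, and every notion below ignores the value at 0.
\<close>

definition multiplicative :: "(nat \<Rightarrow> complex) \<Rightarrow> bool" where
  "multiplicative h \<longleftrightarrow>
     h 1 = 1 \<and> (\<forall>m n. m > 0 \<longrightarrow> n > 0 \<longrightarrow> coprime m n \<longrightarrow> h (m * n) = h m * h n)"

definition dirichlet_conv :: "(nat \<Rightarrow> complex) \<Rightarrow> (nat \<Rightarrow> complex) \<Rightarrow> nat \<Rightarrow> complex" where
  "dirichlet_conv f g n = (\<Sum>d | d dvd n. f d * g (n div d))"

definition arith_supp :: "(nat \<Rightarrow> complex) \<Rightarrow> nat set" where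
  "arith_supp h = {n. n > 0 \<and> h n \<noteq> 0}"

text \<open>Thinness is meant for sets of positive integers, such as supports.\<close>

definition thin :: "nat set \<Rightarrow> bool" where
  "thin A \<longleftrightarrow> (\<lambda>a. 1 / real a) summable_on A"

definition has_asymp_density :: "nat set \<Rightarrow> real \<Rightarrow> bool" where
  "has_asymp_density A \<delta> \<longleftrightarrow>
     ((\<lambda>x::real. real (card {a \<in> A. 1 \<le> a \<and> real a \<le> x}) / x) \<longlongrightarrow> \<delta>) at_top"

definition has_positive_asymp_density :: "nat set \<Rightarrow> bool" where
  "has_positive_asymp_density A \<longleftrightarrow> (\<exists>\<delta>>0. has_asymp_density A \<delta>)"

end

theory Submission
  imports Defs "HOL-Computational_Algebra.Primes"
begin

text \<open>
  Let \<open>S\<close> be the support of \<open>\<nu>\<close>, of density \<open>\<delta>\<close>. For a finite set \<open>P\<close> of primes, the elements of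
  \<open>S\<close> free of primes from \<open>P\<close> have a density \<open>t \<ge> \<delta> * r\<close>, where \<open>r > 0\<close> is the density of all
  integers free of primes from \<open>P\<close>; this is shown by removing one prime at a time.

  If \<open>f\<close> is supported on \<open>[1, y]\<close> and \<open>P\<close> consists of the primes up to \<open>y\<close>, then
  \<open>g (a * b) = \<nu> b * g a\<close> for \<open>a\<close> composed of primes from \<open>P\<close> and \<open>b\<close> free of them, so the support
  of \<open>g\<close> is a disjoint union of dilates of the above set and has a density. Truncating a function
  \<open>f\<close> of thin support at \<open>y\<close> changes \<open>g\<close> only at multiples of elements \<open>d > y\<close> of the support of
  \<open>f\<close>, a set of upper density tending to 0, so the density exists in general.

  For positivity, let \<open>d\<^sub>0\<close> be the least element of the support of \<open>f\<close>. For \<open>b\<close> in \<open>S\<close> free of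
  primes up to \<open>y\<close>, \<open>g (d\<^sub>0 * b) = f d\<^sub>0 * \<nu> b \<noteq> 0\<close> unless some \<open>d > y\<close> in the support of \<open>f\<close>
  divides \<open>d\<^sub>0 * b\<close>. The exceptions have upper density at most \<open>r * \<tau>\<close>, where \<open>\<tau>\<close> is the sum of
  \<open>1 / d\<close> over these \<open>d\<close>, whereas all such \<open>d\<^sub>0 * b\<close> have density \<open>t / d\<^sub>0 \<ge> \<delta> * r / d\<^sub>0\<close>; the
  factor \<open>r\<close> cancels, so a large \<open>y\<close> suffices.
\<close>

section \<open>Counting functions\<close>

definition count_upto :: "nat set \<Rightarrow> real \<Rightarrow> real" where
  "count_upto A x = real (card {a \<in> A. 1 \<le> a \<and> real a \<le> x})"

lemma has_asymp_density_iff: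
  "has_asymp_density A \<delta> \<longleftrightarrow> ((\<lambda>x. count_upto A x / x) \<longlongrightarrow> \<delta>) at_top"
  by (simp add: has_asymp_density_def count_upto_def)

lemma finite_upto: "finite {a \<in> A. 1 \<le> a \<and> real a \<le> x}"
  by (rule finite_subset[of _ "{..nat \<lfloor>x\<rfloor>}"]) (auto simp: le_nat_floor)

lemma count_upto_nonneg: "count_upto A x \<ge> 0"
  by (simp add: count_upto_def)

lemma count_upto_mono: "A \<subseteq> B \<Longrightarrow> count_upto A x \<le> count_upto B x"
  unfolding count_upto_def by (intro of_nat_mono card_mono finite_upto) auto

lemma count_upto_Un_le: "count_upto (A \<union> B) x \<le> count_upto A x + count_upto B x"
proof -
  have "{a \<in> A \<union> B. 1 \<le> a \<and> real a \<le> x} =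
      {a \<in> A. 1 \<le> a \<and> real a \<le> x} \<union> {a \<in> B. 1 \<le> a \<and> real a \<le> x}"
    by auto
  then have "card {a \<in> A \<union> B. 1 \<le> a \<and> real a \<le> x} \<le>
      card {a \<in> A. 1 \<le> a \<and> real a \<le> x} + card {a \<in> B. 1 \<le> a \<and> real a \<le> x}"
    using card_Un_le by simp
  then show ?thesis
    unfolding count_upto_def by linarith
qed

lemma count_upto_UN_disjoint:
  assumes "finite I" "\<And>i j. i \<in> I \<Longrightarrow> j \<in> I \<Longrightarrow> i \<noteq> j \<Longrightarrow> A i \<inter> A j = {}"
  shows "count_upto (\<Union>i\<in>I. A i) x = (\<Sum>i\<in>I. count_upto (A i) x)"
proof -
  have "{a \<in> \<Union>i\<in>I. A i. 1 \<le> a \<and> real a \<le> x} = (\<Union>i\<in>I. {a \<in> A i. 1 \<le> a \<and> real a \<le> x})"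
    by auto
  moreover have "card (\<Union>i\<in>I. {a \<in> A i. 1 \<le> a \<and> real a \<le> x}) =
      (\<Sum>i\<in>I. card {a \<in> A i. 1 \<le> a \<and> real a \<le> x})"
    by (rule card_UN_disjoint) (use assms finite_upto in \<open>blast+\<close>)
  ultimately show ?thesis
    by (simp add: count_upto_def)
qed

lemma count_upto_UN_le:
  assumes "finite I"
  shows "count_upto (\<Union>i\<in>I. A i) x \<le> (\<Sum>i\<in>I. count_upto (A i) x)"
  using assms
proof (induction I rule: finite_induct)
  case empty
  then show ?case by (simp add: count_upto_def)
next
  case (insert i I)
  have "count_upto (\<Union>i\<in>insert i I. A i) x \<le> count_upto (A i) x + count_upto (\<Union>i\<in>I. A i) x"
    using count_upto_Un_le by simp
  then show ?case using insert by simp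
qed

text \<open>Real cutoffs keep this an exact identity: no rounding of \<open>x / real a\<close>
  enters.\<close>

lemma count_upto_dilate:
  assumes "a > 0"
  shows "count_upto ((*) a ` A) x = count_upto A (x / real a)"
proof -
  have "{n \<in> (*) a ` A. 1 \<le> n \<and> real n \<le> x} = (*) a ` {n \<in> A. 1 \<le> n \<and> real n \<le> x / real a}"
    using assms by (auto simp: field_simps image_iff)
  moreover have "card ((*) a ` {n \<in> A. 1 \<le> n \<and> real n \<le> x / real a}) =
      card {n \<in> A. 1 \<le> n \<and> real n \<le> x / real a}"
    by (rule card_image) (use assms in \<open>auto simp: inj_on_def\<close>)
  ultimately show ?thesis by (simp add: count_upto_def)
qed

lemma count_upto_le:
  assumes "x \<ge> 0"
  shows "count_upto A x \<le> x"
proof -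
  have "card {a \<in> A. 1 \<le> a \<and> real a \<le> x} \<le> card {1..nat \<lfloor>x\<rfloor>}"
    by (rule card_mono) (auto simp: le_nat_floor)
  also have "\<dots> = nat \<lfloor>x\<rfloor>" by simp
  finally show ?thesis using assms unfolding count_upto_def
    by linarith
qed

lemma count_upto_multiples_le:
  assumes "d > 0" "x \<ge> 0" "\<And>n. n \<in> A \<Longrightarrow> d dvd n"
  shows "count_upto A x \<le> x / real d"
proof -
  have "A \<subseteq> (*) d ` UNIV" using assms(3) by (auto elim!: dvdE)
  then have "count_upto A x \<le> count_upto ((*) d ` UNIV) x" by (rule count_upto_mono)
  also have "\<dots> = count_upto UNIV (x / real d)" using assms(1) by (rule count_upto_dilate)
  also have "\<dots> \<le> x / real d" using assms(2) by (intro count_upto_le) simp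
  finally show ?thesis .
qed

text \<open>A divisor \<open>d\<close> of a positive \<open>n\<close> up to \<open>x\<close> is
  itself at most \<open>x\<close>, so for each \<open>x\<close> finitely many \<open>d\<close>
  suffice, each contributing at most \<open>x / real d\<close>. The bound holds for every positive
  \<open>x\<close>, so infinite covers cause no interchange of limits.\<close>

lemma count_upto_cover_le:
  assumes "D \<subseteq> {0<..}" "(\<lambda>d. 1 / real d) summable_on D" "x > 0"
    and cover: "\<And>n. n \<in> A \<Longrightarrow> \<exists>d\<in>D. d dvd n"
  shows "count_upto A x \<le> (\<Sum>\<^sub>\<infinity>d\<in>D. 1 / real d) * x"
proof -
  define F where "F = {d \<in> D. 1 \<le> d \<and> real d \<le> x}"
  have fin: "finite F" unfolding F_def by (rule finite_upto)
  have "{a \<in> A. 1 \<le> a \<and> real a \<le> x} = {a \<in> \<Union>d\<in>F. {n \<in> A. d dvd n}. 1 \<le> a \<and> real a \<le> x}"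
  proof (intro equalityI subsetI)
    fix a assume a: "a \<in> {a \<in> A. 1 \<le> a \<and> real a \<le> x}"
    then obtain d where d: "d \<in> D" "d dvd a" using cover by blast
    then have "d \<le> a" using a by (auto intro: dvd_imp_le)
    then have "d \<in> F" using a d assms(1) unfolding F_def by force
    then show "a \<in> {a \<in> \<Union>d\<in>F. {n \<in> A. d dvd n}. 1 \<le> a \<and> real a \<le> x}"
      using a d by auto
  qed auto
  then have "count_upto A x = count_upto (\<Union>d\<in>F. {n \<in> A. d dvd n}) x"
    unfolding count_upto_def by simp
  also have "\<dots> \<le> (\<Sum>d\<in>F. count_upto {n \<in> A. d dvd n} x)" using fin by (rule count_upto_UN_le)
  also have "\<dots> \<le> (\<Sum>d\<in>F. x / real d)"
    by (intro sum_mono count_upto_multiples_le) (use assms(3) in \<open>auto simp: F_def\<close>)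
  also have "\<dots> = (\<Sum>d\<in>F. 1 / real d) * x" by (simp add: sum_distrib_right)
  also have "\<dots> \<le> (\<Sum>\<^sub>\<infinity>d\<in>D. 1 / real d) * x"
    by (intro mult_right_mono finite_sum_le_infsum assms(2) fin) (use assms in \<open>auto simp: F_def\<close>)
  finally show ?thesis .
qed

lemma abs_count_upto_diff_le:
  "\<bar>count_upto A x - count_upto B x\<bar> \<le> count_upto ((A - B) \<union> (B - A)) x"
proof -
  let ?D = "(A - B) \<union> (B - A)"
  have "count_upto A x \<le> count_upto (B \<union> ?D) x" "count_upto B x \<le> count_upto (A \<union> ?D) x"
    by (rule count_upto_mono, blast)+
  then show ?thesis
    using count_upto_Un_le[of B ?D x] count_upto_Un_le[of A ?D x] by linarith
qed

section \<open>Asymptotic density: dilates, disjoint unions, comparison\<close>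

lemma has_asymp_density_dilate:
  assumes "a > 0" "has_asymp_density A \<delta>"
  shows "has_asymp_density ((*) a ` A) (\<delta> / real a)"
proof -
  have "filterlim (\<lambda>x::real. x / real a) at_top at_top"
    unfolding filterlim_at_top
  proof
    fix Z :: real
    show "\<forall>\<^sub>F x in at_top. Z \<le> x / real a"
      using eventually_ge_at_top[of "Z * real a"]
      by eventually_elim (use assms(1) in \<open>simp add: field_simps\<close>)
  qed
  with assms(2) have "((\<lambda>x. count_upto A (x / real a) / (x / real a)) \<longlongrightarrow> \<delta>) at_top"
    unfolding has_asymp_density_iff by (rule filterlim_compose)
  then have "((\<lambda>x. count_upto A (x / real a) / (x / real a) / real a) \<longlongrightarrow> \<delta> / real a) at_top"
    by (intro tendsto_divide) (use assms(1) in auto)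
  then show ?thesis
    using assms(1) by (simp add: has_asymp_density_iff count_upto_dilate)
qed

lemma has_asymp_density_UN_disjoint:
  assumes "finite I" "\<And>i j. i \<in> I \<Longrightarrow> j \<in> I \<Longrightarrow> i \<noteq> j \<Longrightarrow> A i \<inter> A j = {}"
    and "\<And>i. i \<in> I \<Longrightarrow> has_asymp_density (A i) (d i)"
  shows "has_asymp_density (\<Union>i\<in>I. A i) (\<Sum>i\<in>I. d i)"
proof -
  have "((\<lambda>x. \<Sum>i\<in>I. count_upto (A i) x / x) \<longlongrightarrow> (\<Sum>i\<in>I. d i)) at_top"
    using assms(3) by (intro tendsto_sum) (auto simp: has_asymp_density_iff)
  then show ?thesis
    using count_upto_UN_disjoint[OF assms(1,2)] by (simp add: has_asymp_density_iff sum_divide_distrib)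
qed

lemma has_asymp_density_le:
  assumes "has_asymp_density A \<delta>" "((\<lambda>x. u x / x) \<longlongrightarrow> c) at_top"
    and "\<And>x. x > 0 \<Longrightarrow> count_upto A x \<le> u x"
  shows "\<delta> \<le> c"
proof (rule tendsto_le[OF _ assms(2) assms(1)[unfolded has_asymp_density_iff]])
  show "\<forall>\<^sub>F x in at_top. count_upto A x / x \<le> u x / x"
    using eventually_gt_at_top[of 0] by eventually_elim (simp add: assms(3) divide_right_mono)
qed simp

lemma has_asymp_density_le_1:
  assumes "has_asymp_density A \<delta>"
  shows "\<delta> \<le> 1"
proof (rule has_asymp_density_le[OF assms])
  show "((\<lambda>x::real. x / x) \<longlongrightarrow> 1) at_top"
    by (rule tendsto_eventually) (use eventually_gt_at_top[of 0] in \<open>eventually_elim, simp\<close>)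
qed (simp add: count_upto_le)

lemma has_asymp_density_positive_numbers: "has_asymp_density {n. n > 0} 1"
  unfolding has_asymp_density_iff
proof (rule tendsto_sandwich)
  have eq: "count_upto {n. n > 0} x = of_int \<lfloor>x\<rfloor>" if "x > 0" for x :: real
  proof -
    have "{a \<in> {n. n > 0}. 1 \<le> a \<and> real a \<le> x} = {1..nat \<lfloor>x\<rfloor>}"
      using that by (auto simp: le_nat_floor) (linarith)
    then show ?thesis using that by (simp add: count_upto_def)
  qed
  show "\<forall>\<^sub>F x in at_top. 1 - 1 / x \<le> count_upto {n. n > 0} x / x"
    using eventually_gt_at_top[of 0]
  proof eventually_elim
    case (elim x)
    have "x - 1 \<le> of_int \<lfloor>x\<rfloor>" by linarith
    then have "(x - 1) / x \<le> of_int \<lfloor>x\<rfloor> / x" using elim by (simp add: divide_right_mono)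
    then show ?case using elim by (simp add: eq diff_divide_distrib)
  qed
  show "\<forall>\<^sub>F x in at_top. count_upto {n. n > 0} x / x \<le> 1"
    using eventually_gt_at_top[of 0] by eventually_elim (simp add: count_upto_le)
  have "((\<lambda>x::real. 1 - 1 / x) \<longlongrightarrow> 1 - 0) at_top"
    by (intro tendsto_intros tendsto_divide_0[OF tendsto_const]) (simp add: filterlim_at_top_imp_at_infinity filterlim_ident)
  then show "((\<lambda>x::real. 1 - 1 / x) \<longlongrightarrow> 1) at_top" by simp
qed simp

section \<open>Tails of convergent sums and densities by approximation\<close>

lemma infsum_tail_tendsto_0:
  fixes h :: "nat \<Rightarrow> real"
  assumes "h summable_on D"
  shows "(\<lambda>k. \<Sum>\<^sub>\<infinity>d\<in>{d \<in> D. d > k}. h d) \<longlonglongrightarrow> 0"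
proof -
  \<comment> \<open>Extension by zero turns the sum over \<open>D\<close> into an ordinary series
    over the naturals.\<close>
  define H where "H d = (if d \<in> D then h d else 0)" for d
  have H: "(H has_sum (\<Sum>\<^sub>\<infinity>d\<in>D. h d)) UNIV"
    using has_sum_infsum[OF assms]
    by (rule has_sum_cong_neutral[THEN iffD1, rotated -1]) (auto simp: H_def)
  have "(\<lambda>k. \<Sum>d\<le>k. H d) \<longlonglongrightarrow> (\<Sum>\<^sub>\<infinity>d\<in>D. h d)"
    using has_sum_imp_sums[OF H] by (simp add: sums_def_le)
  then have lim: "(\<lambda>k. (\<Sum>\<^sub>\<infinity>d\<in>D. h d) - (\<Sum>d\<le>k. H d)) \<longlonglongrightarrow> 0"
    by (auto intro: tendsto_eq_intros)
  have "(\<Sum>\<^sub>\<infinity>d\<in>D. h d) - (\<Sum>d\<le>k. H d) = (\<Sum>\<^sub>\<infinity>d\<in>{d \<in> D. d > k}. h d)" for k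
  proof -
    have "(\<Sum>\<^sub>\<infinity>d\<in>D. h d) = (\<Sum>\<^sub>\<infinity>d\<in>{d \<in> D. d \<le> k} \<union> {d \<in> D. d > k}. h d)"
      by (rule arg_cong[where f = "infsum h"]) auto
    also have "\<dots> = (\<Sum>\<^sub>\<infinity>d\<in>{d \<in> D. d \<le> k}. h d) + (\<Sum>\<^sub>\<infinity>d\<in>{d \<in> D. d > k}. h d)"
      by (rule infsum_Un_disjoint) (use assms in \<open>auto intro: summable_on_subset_banach\<close>)
    also have "(\<Sum>\<^sub>\<infinity>d\<in>{d \<in> D. d \<le> k}. h d) = (\<Sum>d\<in>{d \<in> D. d \<le> k}. h d)" by simp
    also have "\<dots> = (\<Sum>d\<le>k. H d)"
      by (rule sum.mono_neutral_cong_left) (auto simp: H_def)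
    finally show ?thesis by simp
  qed
  with lim show ?thesis by simp
qed

text \<open>By the covering bound, the relative counts of \<open>A\<close> and \<open>B k\<close>
  differ by at most the tail of the sum of \<open>1 / d\<close> beyond \<open>k\<close>, uniformly
  in \<open>x\<close>. Hence the densities of the \<open>B k\<close> form a Cauchy sequence, and its
  limit is the density of \<open>A\<close>.\<close>

lemma asymp_density_exists_by_approximation:
  assumes D: "D \<subseteq> {0<..}" "(\<lambda>d. 1 / real d) summable_on D"
    and dens: "\<And>k::nat. \<exists>\<delta>. has_asymp_density (B k) \<delta>"
    and diff: "\<And>k n. n \<in> (A - B k) \<union> (B k - A) \<Longrightarrow> \<exists>d\<in>D. d > k \<and> d dvd n"
  shows "\<exists>\<delta>. has_asymp_density A \<delta>"
proof -
  define \<epsilon> where "\<epsilon> k = (\<Sum>\<^sub>\<infinity>d\<in>{d \<in> D. d > k}. 1 / real d)" for k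
  have \<epsilon>0: "\<epsilon> \<longlonglongrightarrow> 0" using infsum_tail_tendsto_0[OF D(2)] unfolding \<epsilon>_def .
  obtain \<delta> where \<delta>: "\<And>k. has_asymp_density (B k) (\<delta> k)" using dens by metis
  have near: "\<bar>count_upto A x / x - count_upto (B k) x / x\<bar> \<le> \<epsilon> k" if "x > 0" for x k
  proof -
    have "\<bar>count_upto A x - count_upto (B k) x\<bar> \<le> \<epsilon> k * x"
      unfolding \<epsilon>_def
    proof (rule order_trans[OF abs_count_upto_diff_le count_upto_cover_le])
      show "\<exists>d\<in>{d \<in> D. d > k}. d dvd n" if "n \<in> (A - B k) \<union> (B k - A)" for n
        using diff[OF that] by blast
    qed (use D that in \<open>auto intro: summable_on_subset_banach\<close>)
    then show ?thesis using that by (simp add: abs_le_iff field_simps)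
  qed
  \<comment> \<open>Both sets are compared with \<open>A\<close> at the same \<open>x\<close> before
    \<open>x\<close> tends to infinity, so no density of \<open>A\<close> is presupposed.\<close>
  have cl: "\<bar>\<delta> k - \<delta> l\<bar> \<le> \<epsilon> k + \<epsilon> l" for k l
  proof (rule tendsto_upperbound)
    show "((\<lambda>x. \<bar>count_upto (B k) x / x - count_upto (B l) x / x\<bar>) \<longlongrightarrow> \<bar>\<delta> k - \<delta> l\<bar>) at_top"
      using \<delta> by (intro tendsto_intros) (auto simp: has_asymp_density_iff)
    show "\<forall>\<^sub>F x in at_top. \<bar>count_upto (B k) x / x - count_upto (B l) x / x\<bar> \<le> \<epsilon> k + \<epsilon> l"
      using eventually_gt_at_top[of 0]
    proof eventually_elim
      case (elim x)
      then show ?case using near[of x k] near[of x l] by linarith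
    qed
  qed simp
  have "Cauchy \<delta>"
  proof (rule metric_CauchyI)
    fix e :: real assume "e > 0"
    then have "\<forall>\<^sub>F k in sequentially. \<epsilon> k < e / 2"
      using \<epsilon>0 by (intro order_tendstoD(2)) auto
    then obtain N where "\<And>k. k \<ge> N \<Longrightarrow> \<epsilon> k < e / 2" by (auto simp: eventually_at_top_linorder)
    then have "\<epsilon> m + \<epsilon> n < e" if "m \<ge> N" "n \<ge> N" for m n
      using that by (metis add_strict_mono field_sum_of_halves)
    then have "dist (\<delta> m) (\<delta> n) < e" if "m \<ge> N" "n \<ge> N" for m n
      using cl[of m n] that unfolding dist_real_def by (meson le_less_trans)
    then show "\<exists>M. \<forall>m\<ge>M. \<forall>n\<ge>M. dist (\<delta> m) (\<delta> n) < e" by blast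
  qed
  then obtain L where L: "\<delta> \<longlonglongrightarrow> L" using Cauchy_convergent_iff convergent_def by blast
  have "has_asymp_density A L"
    unfolding has_asymp_density_iff
  proof (rule tendstoI)
    fix e :: real assume e: "e > 0"
    then have "e / 3 > 0" by simp
    with order_tendstoD(2)[OF \<epsilon>0] tendstoD[OF L]
    have "\<forall>\<^sub>F k in sequentially. \<epsilon> k < e / 3" "\<forall>\<^sub>F k in sequentially. dist (\<delta> k) L < e / 3"
      by blast+
    then have "\<forall>\<^sub>F k in sequentially. \<epsilon> k < e / 3 \<and> dist (\<delta> k) L < e / 3" by eventually_elim auto
    then obtain k where k: "\<epsilon> k < e / 3" "dist (\<delta> k) L < e / 3"
      using eventually_happens'[OF sequentially_bot] by blast
    have "\<forall>\<^sub>F x in at_top. dist (count_upto (B k) x / x) (\<delta> k) < e / 3"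
      using \<delta>[of k] e unfolding has_asymp_density_iff by (intro tendstoD) auto
    then show "\<forall>\<^sub>F x in at_top. dist (count_upto A x / x) L < e"
      using eventually_gt_at_top[of 0]
    proof eventually_elim
      case (elim x)
      then show ?case using near[of x k] k unfolding dist_real_def by linarith
    qed
  qed
  then show ?thesis ..
qed

section \<open>Multiplicative sets and the removal of one prime\<close>

text \<open>The indicator function of \<open>S\<close> is multiplicative. Supports of multiplicative
  functions are of this kind, and the kind is preserved when multiples of primes are removed, which
  permits removing primes one after another.\<close>

definition multiplicative_set :: "nat set \<Rightarrow> bool" where
  "multiplicative_set S \<longleftrightarrow> 0 \<notin> S \<and> 1 \<in> S \<and>
     (\<forall>m n. m > 0 \<longrightarrow> n > 0 \<longrightarrow> coprime m n \<longrightarrow> (m * n \<in> S \<longleftrightarrow> m \<in> S \<and> n \<in> S))"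

lemma prime_power_decomposition:
  fixes n p :: nat
  assumes "prime p" "n > 0"
  obtains k m where "n = p ^ k * m" "\<not> p dvd m" "m > 0"
proof -
  have "\<not> is_unit p" "n \<noteq> 0" using assms by auto
  then obtain m where "n = p ^ multiplicity p n * m" "\<not> p dvd m"
    using multiplicity_decompose'[of n p] by blast
  then show thesis using that assms(2) by (metis gr0I dvd_0_right)
qed

lemma multiplicative_set_prime_power_iff:
  assumes "multiplicative_set S" "prime p" "\<not> p dvd m"
  shows "p ^ k * m \<in> S \<longleftrightarrow> p ^ k \<in> S \<and> m \<in> S"
proof -
  have "m > 0" using assms(3) by (auto intro: gr0I)
  moreover have "coprime (p ^ k) m" using assms(2,3) by (simp add: prime_imp_coprime)
  ultimately show ?thesis
    using assms(1,2) prime_gt_0_nat[of p] unfolding multiplicative_set_def by simp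
qed

text \<open>By the invariance hypothesis the multiples of \<open>p\<close> in \<open>U\<close> are
  exactly the dilate \<open>p * U\<close>, of density \<open>u / p\<close>; this is
  subtracted.\<close>

lemma has_asymp_density_nonmultiples:
  assumes "p > 1" "has_asymp_density U u" "\<And>n. p * n \<in> U \<longleftrightarrow> n \<in> U"
  shows "has_asymp_density {n \<in> U. \<not> p dvd n} (u * (1 - 1 / real p))"
proof -
  define V where "V = {n \<in> U. \<not> p dvd n}"
  define W where "W i = (if i then V else (*) p ` U)" for i
  have U: "U = (\<Union>i\<in>UNIV. W i)"
    using assms(3) by (auto simp: V_def W_def UNIV_bool elim!: dvdE)
  have "count_upto U x = count_upto V x + count_upto ((*) p ` U) x" for x
  proof -
    have "count_upto U x = count_upto (\<Union>i\<in>UNIV. W i) x"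
      using U by (rule arg_cong)
    also have "\<dots> = (\<Sum>i\<in>UNIV. count_upto (W i) x)"
      by (rule count_upto_UN_disjoint) (auto simp: V_def W_def split: if_splits)
    also have "\<dots> = count_upto V x + count_upto ((*) p ` U) x"
      by (simp add: UNIV_bool W_def)
    finally show ?thesis .
  qed
  then have *: "count_upto V x / x = count_upto U x / x - count_upto ((*) p ` U) x / x" for x
    by (simp add: diff_divide_distrib[symmetric])
  have "has_asymp_density ((*) p ` U) (u / real p)"
    using assms by (intro has_asymp_density_dilate) auto
  then have "has_asymp_density V (u - u / real p)"
    using assms(2) unfolding has_asymp_density_iff * by (intro tendsto_diff)
  then show ?thesis by (simp add: V_def algebra_simps)
qed

text \<open>Iterating \<open>step\<close> from \<open>M0\<close> shrinks the eventual bound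
  geometrically.\<close>

lemma tendsto_0_if_eventually_contracting:
  fixes \<beta> :: "'a \<Rightarrow> real"
  assumes "0 \<le> c" "c < 1" "M0 > 0" "\<forall>\<^sub>F x in F. \<bar>\<beta> x\<bar> \<le> M0"
    and step: "\<And>M. M > 0 \<Longrightarrow> \<forall>\<^sub>F x in F. \<bar>\<beta> x\<bar> \<le> M \<Longrightarrow> \<forall>\<^sub>F x in F. \<bar>\<beta> x\<bar> \<le> c * M"
  shows "(\<beta> \<longlongrightarrow> 0) F"
proof -
  \<comment> \<open>The midpoint of \<open>c\<close> and 1 is positive even if \<open>c = 0\<close>,
    so the bounds \<open>c' ^ n * M0\<close> stay positive, as \<open>step\<close> demands.\<close>
  define c' where "c' = (c + 1) / 2"
  have c': "0 < c'" "c' < 1" "c \<le> c'" using assms by (auto simp: c'_def)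
  have ev: "\<forall>\<^sub>F x in F. \<bar>\<beta> x\<bar> \<le> c' ^ n * M0" for n
  proof (induction n)
    case 0
    then show ?case using assms by simp
  next
    case (Suc n)
    have "\<forall>\<^sub>F x in F. \<bar>\<beta> x\<bar> \<le> c * (c' ^ n * M0)"
      using c' assms Suc by (intro step) auto
    moreover have "c * (c' ^ n * M0) \<le> c' ^ Suc n * M0"
      using c' assms by (simp add: mult_right_mono)
    ultimately show ?case by (auto elim!: eventually_mono)
  qed
  show ?thesis
  proof (rule tendstoI)
    fix e :: real assume "e > 0"
    have "(\<lambda>n. c' ^ n * M0) \<longlonglongrightarrow> 0 * M0"
      using c' by (intro tendsto_mult LIMSEQ_power_zero tendsto_const) auto
    then have "\<forall>\<^sub>F n in sequentially. c' ^ n * M0 < e"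
      using \<open>e > 0\<close> by (intro order_tendstoD(2)[of _ 0]) auto
    then obtain n where "c' ^ n * M0 < e"
      using eventually_happens'[OF sequentially_bot] by blast
    with ev[of n] show "\<forall>\<^sub>F x in F. dist (\<beta> x) 0 < e"
      by (auto elim!: eventually_mono)
  qed
qed

text \<open>Sorted by their exact power of \<open>p\<close>, the elements of \<open>S\<close> fall
  into disjoint dilates \<open>p ^ k * T\<close>, where \<open>T\<close> is the part prime to
  \<open>p\<close>. Cutting off at \<open>k < K\<close> loses only multiples of
  \<open>p ^ K\<close>. The term \<open>k = 0\<close> is the count of \<open>T\<close> at
  \<open>x\<close> itself; it stands apart so that the relation can be solved for it.\<close>

lemma count_upto_prime_power_expansion:
  assumes S: "multiplicative_set S" and p: "prime p" and "x > 0" and "K > 0"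
  shows "\<bar>count_upto S x - count_upto {n \<in> S. \<not> p dvd n} x
      - (\<Sum>k\<in>{k. 1 \<le> k \<and> k < K \<and> p ^ k \<in> S}. count_upto {n \<in> S. \<not> p dvd n} (x / real p ^ k))\<bar>
    \<le> x * (1 / real p) ^ K"
proof -
  define T where "T = {n \<in> S. \<not> p dvd n}"
  define J where "J = {k. k < K \<and> p ^ k \<in> S}"
  have p0: "p > 0" using p by (rule prime_gt_0_nat)
  have J: "J = insert 0 {k. 1 \<le> k \<and> k < K \<and> p ^ k \<in> S}"
    using S \<open>K > 0\<close> by (auto simp: J_def multiplicative_set_def Suc_le_eq)
  define B where "B = (\<Union>k\<in>J. (*) (p ^ k) ` T)"
  have "count_upto B x = (\<Sum>k\<in>J. count_upto ((*) (p ^ k) ` T) x)"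
    unfolding B_def
  proof (rule count_upto_UN_disjoint)
    fix i j :: nat assume ij: "i \<noteq> j"
    have "False" if n: "n \<in> (*) (p ^ i) ` T" "n \<in> (*) (p ^ j) ` T" for n
    proof -
      obtain a b where ab: "p ^ i * a = p ^ j * b" "\<not> p dvd a" "\<not> p dvd b"
        using n unfolding T_def by auto
      \<comment> \<open>The multiplicity of \<open>p\<close> recovers the exponent, so distinct
        dilates are disjoint.\<close>
      have "multiplicity p (p ^ k * c) = k" if "\<not> p dvd c" for k c
        by (rule multiplicity_eqI) (use p0 that in simp_all)
      then show False using ab ij by metis
    qed
    then show "(*) (p ^ i) ` T \<inter> (*) (p ^ j) ` T = {}" by blast
  qed (simp add: J_def)
  also have "\<dots> = (\<Sum>k\<in>J. count_upto T (x / real p ^ k))"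
    using p0 by (simp add: count_upto_dilate)
  also have "\<dots> = count_upto T x
      + (\<Sum>k\<in>{k. 1 \<le> k \<and> k < K \<and> p ^ k \<in> S}. count_upto T (x / real p ^ k))"
    unfolding J by (subst sum.insert) auto
  finally have B: "count_upto B x = count_upto T x
      + (\<Sum>k\<in>{k. 1 \<le> k \<and> k < K \<and> p ^ k \<in> S}. count_upto T (x / real p ^ k))" .
  have dvd: "p ^ K dvd n" if n: "n \<in> (S - B) \<union> (B - S)" for n
  proof -
    have "B \<subseteq> S"
      using multiplicative_set_prime_power_iff[OF S p] by (auto simp: B_def J_def T_def)
    then have nS: "n \<in> S" "n \<notin> B" using n by auto
    then have "n > 0" using S by (auto simp: multiplicative_set_def intro: gr0I)
    then obtain k m where km: "n = p ^ k * m" "\<not> p dvd m" "m > 0"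
      using prime_power_decomposition[OF p] by blast
    then have "p ^ k \<in> S" "m \<in> T"
      using nS multiplicative_set_prime_power_iff[OF S p] by (auto simp: T_def)
    then have "\<not> k < K" using nS km by (auto simp: B_def J_def)
    then show ?thesis using km by (simp add: le_imp_power_dvd)
  qed
  have "\<bar>count_upto S x - count_upto B x\<bar> \<le> x / real (p ^ K)"
    by (rule order_trans[OF abs_count_upto_diff_le count_upto_multiples_le])
      (use p0 dvd \<open>x > 0\<close> in auto)
  then show ?thesis
    unfolding B T_def[symmetric] by (simp add: power_divide diff_diff_eq)
qed

text \<open>
  With \<open>T\<close> the set of elements of \<open>S\<close> prime to \<open>p\<close>, \<open>S\<close> is the disjoint union of the sets
  \<open>p ^ k * T\<close> with \<open>p ^ k \<in> S\<close>. If some power is missing from \<open>S\<close>, the sum \<open>e\<close> of \<open>1 / p ^ k\<close> over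
  the occurring \<open>k \<ge> 1\<close> is less than 1 (also for \<open>p = 2\<close>), so the error of the counting function
  of \<open>T\<close> contracts by a factor close to \<open>e\<close>; otherwise \<open>T = S - p * S\<close>.
\<close>

lemma asymp_density_remove_prime:
  assumes S: "multiplicative_set S" and p: "prime p" and \<delta>: "has_asymp_density S \<delta>"
  shows "\<exists>t. has_asymp_density {n \<in> S. \<not> p dvd n} t \<and> \<delta> * (1 - 1 / real p) \<le> t"
proof (cases "\<forall>k. p ^ k \<in> S")
  case True
  have "p * n \<in> S \<longleftrightarrow> n \<in> S" for n
  proof (cases "n = 0")
    case False
    then obtain k m where "n = p ^ k * m" "\<not> p dvd m"
      using prime_power_decomposition[OF p] by blast
    then show ?thesis
      using True[rule_format, of k] True[rule_format, of "Suc k"]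
        multiplicative_set_prime_power_iff[OF S p, of m k]
        multiplicative_set_prime_power_iff[OF S p, of m "Suc k"] by (simp add: mult.assoc)
  qed simp
  then have "has_asymp_density {n \<in> S. \<not> p dvd n} (\<delta> * (1 - 1 / real p))"
    using prime_gt_1_nat[OF p] \<delta> by (intro has_asymp_density_nonmultiples)
  then show ?thesis by blast
next
  case False
  then obtain j where j: "p ^ j \<notin> S" by blast
  define T where "T = {n \<in> S. \<not> p dvd n}"
  define q where "q = 1 / real p"
  have p2: "p \<ge> 2" using p by (rule prime_ge_2_nat)
  have q: "0 < q" "q \<le> 1 / 2" using p2 by (auto simp: q_def field_simps)
  \<comment> \<open>Exponent 0 is left out: it belongs to \<open>T\<close> itself and reappears as
    the 1 in \<open>1 + e\<close>. The full geometric series \<open>v\<close> dominates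
    \<open>w\<close>.\<close>
  define w where "w k = (if 1 \<le> k \<and> p ^ k \<in> S then q ^ k else 0)" for k
  define v where "v k = (if 1 \<le> k then q ^ k else 0)" for k :: nat
  have v: "v sums (q / (1 - q))"
  proof -
    have "(\<lambda>k. q * q ^ k) sums (q * (1 / (1 - q)))"
      using q by (intro sums_mult geometric_sums) auto
    then have "(\<lambda>k. v (Suc k)) sums (q / (1 - q))" by (simp add: v_def)
    then show ?thesis by (subst (asm) sums_Suc_iff) (simp add: v_def)
  qed
  have wv: "0 \<le> w k" "w k \<le> v k" for k using q by (auto simp: w_def v_def)
  have sw: "summable w"
    using v wv by (intro summable_comparison_test'[of v 0 w]) (auto simp: sums_iff)
  define e where "e = suminf w"
  have e0: "e \<ge> 0" unfolding e_def using sw wv by (intro suminf_nonneg)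
  \<comment> \<open>Since \<open>p ^ 0 = 1\<close> lies in \<open>S\<close>, the missing exponent
    \<open>j\<close> is positive and \<open>w\<close> loses the term \<open>q ^ j\<close> of
    \<open>v\<close>. For \<open>p = 2\<close>, where \<open>q / (1 - q) = 1\<close>, this
    strictness is what yields \<open>e < 1\<close>.\<close>
  have eq: "e < q / (1 - q)"
  proof -
    have "1 \<le> j" using j S by (cases j) (auto simp: multiplicative_set_def)
    then have "w j < v j" using j q by (auto simp: w_def v_def)
    then have "suminf (\<lambda>k. v k - w k) > 0"
      using v sw wv by (intro suminf_pos2[of _ j]) (auto simp: sums_iff intro: summable_diff)
    then show ?thesis
      using suminf_diff[OF sums_summable[OF v] sw] sums_unique[OF v] by (simp add: e_def)
  qed
  have e1: "e < 1"
  proof -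
    have "q / (1 - q) \<le> 1" using q by (simp add: field_simps)
    then show ?thesis using eq by linarith
  qed
  \<comment> \<open>The only candidate: if \<open>T\<close> has density \<open>t\<close>, its
    dilates in \<open>S\<close> add up to \<open>\<delta> = t * (1 + e)\<close>.\<close>
  define t where "t = \<delta> / (1 + e)"
  have \<delta>_eq: "\<delta> = t * (1 + e)" using e0 by (simp add: t_def)
  have \<delta>0: "\<delta> \<ge> 0"
    by (rule tendsto_lowerbound[OF \<delta>[unfolded has_asymp_density_iff]])
      (auto intro!: eventually_mono[OF eventually_gt_at_top[of 0]] simp: count_upto_nonneg)
  have t0: "t \<ge> 0" using \<delta>0 e0 by (simp add: t_def)
  define \<beta> where "\<beta> x = count_upto T x / x - t" for x
  have "(\<beta> \<longlongrightarrow> 0) at_top"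
  proof (rule tendsto_0_if_eventually_contracting)
    show "0 \<le> (1 + e) / 2" "(1 + e) / 2 < 1" using e0 e1 by auto
    show "1 + t > 0" using t0 by linarith
    show "\<forall>\<^sub>F x in at_top. \<bar>\<beta> x\<bar> \<le> 1 + t"
      using eventually_gt_at_top[of 0]
    proof eventually_elim
      case (elim x)
      have "0 \<le> count_upto T x / x" "count_upto T x / x \<le> 1"
        using elim count_upto_nonneg[of T x] count_upto_le[of x T] by auto
      then show ?case using t0 by (auto simp: \<beta>_def)
    qed
    fix M :: real assume M: "M > 0" and ev: "\<forall>\<^sub>F x in at_top. \<bar>\<beta> x\<bar> \<le> M"
    \<comment> \<open>Three errors of size \<open>\<epsilon>\<close> will occur: from the count of
      \<open>S\<close>, the truncation of \<open>e\<close> and the remainder \<open>R\<close>.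
      Together they make \<open>(1 - e) * M / 2\<close>, which added to \<open>e * M\<close> gives
      \<open>(1 + e) / 2 * M\<close>.\<close>
    define \<epsilon> where "\<epsilon> = (1 - e) * M / 6"
    have \<epsilon>: "\<epsilon> > 0" using e1 M by (simp add: \<epsilon>_def)
    have "(\<lambda>K. t * (e - (\<Sum>k<K. w k))) \<longlonglongrightarrow> t * (e - e)"
      using sw unfolding e_def by (intro tendsto_intros summable_LIMSEQ)
    then have "\<forall>\<^sub>F K in sequentially. t * (e - (\<Sum>k<K. w k)) < \<epsilon>"
      using \<epsilon> by (intro order_tendstoD(2)[of _ 0]) auto
    moreover have "\<forall>\<^sub>F K in sequentially. q ^ K < \<epsilon>"
      using \<epsilon> q by (intro order_tendstoD(2)[of _ 0] LIMSEQ_power_zero) auto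
    ultimately have "\<forall>\<^sub>F K in sequentially. t * (e - (\<Sum>k<K. w k)) < \<epsilon> \<and> q ^ K < \<epsilon> \<and> K > 0"
      using eventually_gt_at_top[of 0] by eventually_elim auto
    then obtain K where K: "t * (e - (\<Sum>k<K. w k)) < \<epsilon>" "q ^ K < \<epsilon>" "K > 0"
      using eventually_happens'[OF sequentially_bot] by blast
    define J where "J = {k. 1 \<le> k \<and> k < K \<and> p ^ k \<in> S}"
    have finJ: "finite J" by (simp add: J_def)
    define eK where "eK = (\<Sum>k\<in>J. q ^ k)"
    have eK: "eK = (\<Sum>k<K. w k)"
      unfolding eK_def by (rule sum.mono_neutral_cong_left) (auto simp: J_def w_def)
    have eKe: "eK \<le> e" unfolding eK e_def by (rule sum_le_suminf) (use sw wv in auto)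
    have "\<forall>\<^sub>F x in at_top. \<bar>count_upto S x / x - \<delta>\<bar> \<le> \<epsilon>"
      using tendstoD[OF \<delta>[unfolded has_asymp_density_iff] \<epsilon>]
      by eventually_elim (simp add: dist_real_def)
    moreover have "\<forall>\<^sub>F x in at_top. \<forall>k\<in>J. \<bar>\<beta> (x / real p ^ k)\<bar> \<le> M"
    proof (rule eventually_ball_finite[OF finJ], rule)
      fix k
      obtain Z where Z: "\<And>x. x \<ge> Z \<Longrightarrow> \<bar>\<beta> x\<bar> \<le> M"
        using ev by (auto simp: eventually_at_top_linorder)
      show "\<forall>\<^sub>F x in at_top. \<bar>\<beta> (x / real p ^ k)\<bar> \<le> M"
        using eventually_ge_at_top[of "Z * real p ^ k"]
        by eventually_elim (use p2 in \<open>auto intro!: Z simp: field_simps\<close>)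
    qed
    ultimately show "\<forall>\<^sub>F x in at_top. \<bar>\<beta> x\<bar> \<le> (1 + e) / 2 * M"
      using eventually_gt_at_top[of 0]
    proof eventually_elim
      case (elim x)
      define R where "R = count_upto S x - count_upto T x - (\<Sum>k\<in>J. count_upto T (x / real p ^ k))"
      have "\<bar>R\<bar> \<le> x * q ^ K"
        using count_upto_prime_power_expansion[OF S p _ K(3), of x] elim(3)
        by (simp add: R_def T_def J_def q_def)
      then have R: "\<bar>R / x\<bar> \<le> q ^ K" using elim(3) by (simp add: field_simps)
      have "count_upto T (x / real p ^ k) / x = q ^ k * (\<beta> (x / real p ^ k) + t)" for k
        using p2 elim(3) by (simp add: \<beta>_def q_def field_simps)
      then have "(\<Sum>k\<in>J. count_upto T (x / real p ^ k)) / x = (\<Sum>k\<in>J. q ^ k * \<beta> (x / real p ^ k)) + eK * t"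
        by (simp add: sum_divide_distrib eK_def distrib_left sum.distrib sum_distrib_right)
      moreover have "R / x = count_upto S x / x - count_upto T x / x
          - (\<Sum>k\<in>J. count_upto T (x / real p ^ k)) / x"
        by (simp add: R_def diff_divide_distrib)
      \<comment> \<open>Solved for \<open>\<beta> x\<close>, the expansion involves
        \<open>\<beta>\<close> only at the arguments \<open>x / p ^ k\<close> with
        \<open>k \<ge> 1\<close>, with weights of total \<open>eK \<le> e\<close>; this is the
        contraction.\<close>
      ultimately have *: "\<beta> x = (count_upto S x / x - \<delta>) + t * (e - eK)
          - (\<Sum>k\<in>J. q ^ k * \<beta> (x / real p ^ k)) - R / x"
        by (simp add: \<beta>_def \<delta>_eq algebra_simps)
      have "\<bar>\<Sum>k\<in>J. q ^ k * \<beta> (x / real p ^ k)\<bar> \<le> (\<Sum>k\<in>J. q ^ k * M)"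
        by (rule order_trans[OF sum_abs sum_mono]) (use elim(2) q in \<open>auto simp: abs_mult\<close>)
      also have "\<dots> = eK * M" by (simp add: eK_def sum_distrib_right)
      also have "\<dots> \<le> e * M" using eKe M by simp
      finally have "\<bar>\<beta> x\<bar> \<le> \<epsilon> + \<epsilon> + e * M + \<epsilon>"
        unfolding * using elim(1) R K(1,2) mult_nonneg_nonneg[OF t0, of "e - eK"] eKe
        unfolding eK[symmetric] by linarith
      also have "\<dots> = (1 + e) / 2 * M" by (simp add: \<epsilon>_def field_simps)
      finally show ?case .
    qed
  qed
  then have "has_asymp_density T t"
    unfolding has_asymp_density_iff \<beta>_def by (simp add: LIM_zero_iff)
  moreover have "\<delta> * (1 - 1 / real p) \<le> t"
  proof -
    \<comment> \<open>This restates \<open>e < q / (1 - q)\<close> as a bound on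
      \<open>1 + e\<close>, which is below \<open>1 / (1 - q)\<close>.\<close>
    have "(1 + e) * (1 - q) \<le> 1" using eq q by (simp add: field_simps)
    then have "t * ((1 + e) * (1 - q)) \<le> t * 1" using t0 by (rule mult_left_mono)
    then show ?thesis by (simp add: \<delta>_eq q_def mult.assoc)
  qed
  ultimately show ?thesis unfolding T_def by blast
qed

section \<open>Rough and smooth numbers\<close>

definition rough :: "nat set \<Rightarrow> nat set" where
  "rough P = {n. n > 0 \<and> (\<forall>p\<in>P. \<not> p dvd n)}"

definition smooth :: "nat set \<Rightarrow> nat set" where
  "smooth P = {n. n > 0 \<and> (\<forall>p. prime p \<longrightarrow> p dvd n \<longrightarrow> p \<in> P)}"

lemma multiplicative_set_Int_rough:
  assumes "multiplicative_set S" "\<And>p. p \<in> P \<Longrightarrow> prime p"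
  shows "multiplicative_set (S \<inter> rough P)"
proof -
  have 1: "1 \<in> rough P" using assms(2) not_prime_1 by (force simp: rough_def)
  have "m * n \<in> rough P \<longleftrightarrow> m \<in> rough P \<and> n \<in> rough P" for m n
    using assms(2) by (auto simp: rough_def prime_dvd_mult_iff)
  with 1 assms(1) show ?thesis by (simp add: multiplicative_set_def) blast
qed

text \<open>Induction on \<open>P\<close>. A further prime \<open>p\<close> multiplies
  \<open>r\<close> by exactly \<open>1 - 1 / p\<close>, while \<open>t\<close> becomes at least
  \<open>t * (1 - 1 / p)\<close>, so \<open>\<delta> * r \<le> t\<close> persists.\<close>

lemma asymp_density_rough:
  assumes "finite P" "\<And>p. p \<in> P \<Longrightarrow> prime p" "multiplicative_set S" "has_asymp_density S \<delta>"
  shows "\<exists>t r. has_asymp_density (S \<inter> rough P) t \<and> has_asymp_density (rough P) r \<and> r > 0 \<and> \<delta> * r \<le> t"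
  using assms(1,2)
proof (induction P rule: finite_induct)
  case empty
  have "S \<inter> rough {} = S" "rough {} = {n. n > 0}"
    using assms(3) by (auto simp: rough_def multiplicative_set_def intro: gr0I)
  with assms(4) has_asymp_density_positive_numbers
  have "has_asymp_density (S \<inter> rough {}) \<delta>" "has_asymp_density (rough {}) 1" by simp_all
  then show ?case by (metis mult.right_neutral order_refl zero_less_one)
next
  case (insert p P)
  have p: "prime p" using insert by simp
  obtain t r where tr: "has_asymp_density (S \<inter> rough P) t" "has_asymp_density (rough P) r"
      "r > 0" "\<delta> * r \<le> t"
    using insert.IH insert.prems by blast
  have eq: "{n \<in> S \<inter> rough P. \<not> p dvd n} = S \<inter> rough (insert p P)"
      "{n \<in> rough P. \<not> p dvd n} = rough (insert p P)"
    by (auto simp: rough_def)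
  have "multiplicative_set (S \<inter> rough P)"
    using insert assms(3) by (intro multiplicative_set_Int_rough) auto
  then obtain t' where t': "has_asymp_density (S \<inter> rough (insert p P)) t'" "t * (1 - 1 / real p) \<le> t'"
    using asymp_density_remove_prime[OF _ p tr(1)] unfolding eq by blast
  have p1: "p > 1" using p by (rule prime_gt_1_nat)
  \<comment> \<open>The new prime lies outside \<open>P\<close>, so multiplying by it changes no
    divisibility by members of \<open>P\<close>.\<close>
  have "p * n \<in> rough P \<longleftrightarrow> n \<in> rough P" for n
  proof -
    have "q dvd p * n \<longleftrightarrow> q dvd n" if "q \<in> P" for q
    proof -
      have "prime q" "q \<noteq> p" using that insert by auto
      then have "\<not> q dvd p" using p primes_dvd_imp_eq by blast
      then show ?thesis using \<open>prime q\<close> by (simp add: prime_dvd_mult_iff)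
    qed
    then show ?thesis using p1 by (auto simp: rough_def)
  qed
  then have r': "has_asymp_density (rough (insert p P)) (r * (1 - 1 / real p))"
    using has_asymp_density_nonmultiples[OF p1 tr(2)] unfolding eq by blast
  have c: "1 - 1 / real p > 0" using p1 by simp
  have "\<delta> * (r * (1 - 1 / real p)) \<le> t * (1 - 1 / real p)"
    using tr(4) c by (simp add: mult.assoc[symmetric])
  then have "\<delta> * (r * (1 - 1 / real p)) \<le> t'" using t'(2) by linarith
  moreover have "r * (1 - 1 / real p) > 0" using tr(3) c by (rule mult_pos_pos)
  ultimately show ?case using t'(1) r' by blast
qed

lemma coprime_smooth_rough:
  assumes "a \<in> smooth P" "b \<in> rough P"
  shows "coprime a b"
proof (rule ccontr)
  assume "\<not> coprime a b"
  then have "gcd a b \<noteq> 1" by (simp add: coprime_iff_gcd_eq_1)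
  then obtain p where "prime p" "p dvd gcd a b" using prime_factor_nat by blast
  then show False using assms by (auto simp: smooth_def rough_def)
qed

lemma smooth_rough_decomposition:
  assumes "\<And>p. p \<in> P \<Longrightarrow> prime p" "n > 0"
  obtains a b where "n = a * b" "a \<in> smooth P" "b \<in> rough P"
proof -
  \<comment> \<open>Strong induction, moving one prime factor from \<open>P\<close> into
    \<open>a\<close> at a time.\<close>
  have "\<exists>a b. n = a * b \<and> a \<in> smooth P \<and> b \<in> rough P"
    using assms(2)
  proof (induction n rule: less_induct)
    case (less n)
    show ?case
    proof (cases "n \<in> rough P")
      case True
      then show ?thesis by (intro exI[of _ 1] exI[of _ n]) (auto simp: smooth_def)
    next
      case False
      then obtain p m where p: "p \<in> P" "n = p * m" using less by (auto simp: rough_def elim: dvdE)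
      then have "prime p" "m > 0" using assms(1) less by (auto intro: gr0I)
      moreover have "m < n" using prime_gt_1_nat[OF \<open>prime p\<close>] p(2) \<open>m > 0\<close> by simp
      ultimately obtain a b where "m = a * b" "a \<in> smooth P" "b \<in> rough P"
        using less.IH by blast
      moreover have "p * a \<in> smooth P"
        using \<open>a \<in> smooth P\<close> \<open>prime p\<close> p(1) prime_gt_0_nat[of p] primes_dvd_imp_eq[of _ p]
        by (auto simp: smooth_def prime_dvd_mult_iff)
      ultimately show ?thesis using p(2) by (metis mult.assoc)
    qed
  qed
  then show thesis using that by blast
qed

text \<open>As \<open>a\<close> is coprime to \<open>b'\<close> and divides \<open>a' * b'\<close>,
  it divides \<open>a'\<close>; the situation is symmetric.\<close>

lemma smooth_rough_unique:
  assumes "a * b = a' * b'" "a \<in> smooth P" "a' \<in> smooth P" "b \<in> rough P" "b' \<in> rough P"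
  shows "a = a'"
proof (rule dvd_antisym)
  show "a dvd a'"
    using assms coprime_smooth_rough[of a P b'] by (metis coprime_dvd_mult_left_iff dvd_triv_left)
  show "a' dvd a"
    using assms coprime_smooth_rough[of a' P b] by (metis coprime_dvd_mult_left_iff dvd_triv_left)
qed

text \<open>
  The dilates of \<open>rough P\<close> by smooth numbers are disjoint, so their densities add up to at most 1.
\<close>

lemma summable_on_inverse_smooth:
  assumes "has_asymp_density (rough P) r" "r > 0"
  shows "(\<lambda>a. 1 / real a) summable_on smooth P"
proof (rule nonneg_bounded_partial_sums_imp_summable_on[of _ _ "1 / r"])
  show "\<forall>\<^sub>F F in finite_subsets_at_top (smooth P). (\<Sum>a\<in>F. 1 / real a) \<le> 1 / r"
  proof (rule eventually_finite_subsets_at_top_weakI)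
    fix F assume F: "finite F" "F \<subseteq> smooth P"
    have "has_asymp_density (\<Union>a\<in>F. (*) a ` rough P) (\<Sum>a\<in>F. r / real a)"
    proof (rule has_asymp_density_UN_disjoint[OF F(1)])
      show "(*) i ` rough P \<inter> (*) j ` rough P = {}" if "i \<in> F" "j \<in> F" "i \<noteq> j" for i j
        using that F(2) smooth_rough_unique[of i _ j _ P] by blast
      show "has_asymp_density ((*) a ` rough P) (r / real a)" if "a \<in> F" for a
        using that F(2) assms(1) by (intro has_asymp_density_dilate) (auto simp: smooth_def)
    qed
    then have "(\<Sum>a\<in>F. r / real a) \<le> 1" by (rule has_asymp_density_le_1)
    then have "r * (\<Sum>a\<in>F. 1 / real a) \<le> 1" by (simp add: sum_distrib_left)
    then show "(\<Sum>a\<in>F. 1 / real a) \<le> 1 / r" using assms(2) by (simp add: field_simps)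
  qed
qed simp

text \<open>\<open>I\<close> may be infinite. Its members up to \<open>k\<close> give a finite
  disjoint union; everything missed is a multiple of a larger member of \<open>I\<close>, and the
  reciprocals of these are summable, so approximation applies.\<close>

lemma asymp_density_smooth_dilates:
  assumes "has_asymp_density (rough P) r" "r > 0" "T \<subseteq> rough P" "has_asymp_density T t" "I \<subseteq> smooth P"
  shows "\<exists>\<delta>. has_asymp_density (\<Union>a\<in>I. (*) a ` T) \<delta>"
proof (rule asymp_density_exists_by_approximation[of I])
  show "I \<subseteq> {0<..}" using assms(5) by (auto simp: smooth_def)
  show "(\<lambda>a. 1 / real a) summable_on I"
    using summable_on_inverse_smooth[OF assms(1,2)] assms(5) by (rule summable_on_subset_banach)
  fix k :: nat
  have "has_asymp_density (\<Union>a\<in>{a \<in> I. a \<le> k}. (*) a ` T) (\<Sum>a\<in>{a \<in> I. a \<le> k}. t / real a)"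
  proof (rule has_asymp_density_UN_disjoint)
    show "(*) i ` T \<inter> (*) j ` T = {}"
      if "i \<in> {a \<in> I. a \<le> k}" "j \<in> {a \<in> I. a \<le> k}" "i \<noteq> j" for i j
      using that assms(3,5) smooth_rough_unique[of i _ j _ P] by blast
    show "has_asymp_density ((*) a ` T) (t / real a)" if "a \<in> {a \<in> I. a \<le> k}" for a
      using that assms(4,5) by (intro has_asymp_density_dilate) (auto simp: smooth_def)
  qed simp
  then show "\<exists>\<delta>. has_asymp_density (\<Union>a\<in>{a \<in> I. a \<le> k}. (*) a ` T) \<delta>" by blast
  show "\<exists>d\<in>I. d > k \<and> d dvd n"
    if n: "n \<in> ((\<Union>a\<in>I. (*) a ` T) - (\<Union>a\<in>{a \<in> I. a \<le> k}. (*) a ` T)) \<union>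
      ((\<Union>a\<in>{a \<in> I. a \<le> k}. (*) a ` T) - (\<Union>a\<in>I. (*) a ` T))" for n
  proof -
    obtain a where "a \<in> I" "n \<in> (*) a ` T" "\<not> a \<le> k" using n by blast
    then show ?thesis by (intro bexI[of _ a]) auto
  qed
qed

section \<open>Existence of the density for convolutions\<close>

lemma multiplicative_set_arith_supp:
  assumes "multiplicative \<nu>"
  shows "multiplicative_set (arith_supp \<nu>)"
  using assms unfolding multiplicative_def multiplicative_set_def arith_supp_def by auto

lemma mem_smooth_primes_le:
  assumes "d > 0" "d \<le> y"
  shows "d \<in> smooth {p. prime p \<and> p \<le> y}"
  using assms by (auto simp: smooth_def dest: dvd_imp_le)

lemma asymp_density_conv_finite_support:
  assumes \<nu>: "multiplicative \<nu>" and \<delta>: "has_asymp_density (arith_supp \<nu>) \<delta>"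
    and f: "\<And>d. d > y \<Longrightarrow> f d = 0"
  shows "\<exists>\<gamma>. has_asymp_density (arith_supp (dirichlet_conv f \<nu>)) \<gamma>"
proof -
  define P where "P = {p::nat. prime p \<and> p \<le> y}"
  define g where "g = dirichlet_conv f \<nu>"
  define T where "T = arith_supp \<nu> \<inter> rough P"
  have P: "finite P" "\<And>p. p \<in> P \<Longrightarrow> prime p" by (auto simp: P_def)
  obtain t r where tr: "has_asymp_density T t" "has_asymp_density (rough P) r" "r > 0"
    using asymp_density_rough[OF P multiplicative_set_arith_supp[OF \<nu>] \<delta>] unfolding T_def by blast
  \<comment> \<open>Only \<open>d \<le> y\<close> contribute. They are smooth, hence coprime to
    \<open>b\<close>, so a \<open>d\<close> dividing \<open>a * b\<close> divides \<open>a\<close>;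
    then \<open>\<nu> b\<close> factors out because \<open>a div d\<close> is coprime to
    \<open>b\<close>.\<close>
  have g_eq: "g (a * b) = \<nu> b * g a" if a: "a \<in> smooth P" and b: "b \<in> rough P" for a b
  proof -
    have pos: "a > 0" "b > 0" using a b by (auto simp: smooth_def rough_def)
    have "g (a * b) = (\<Sum>d | d dvd a. f d * \<nu> (a * b div d))"
      unfolding g_def dirichlet_conv_def
    proof (rule sum.mono_neutral_right)
      show "\<forall>d\<in>{d. d dvd a * b} - {d. d dvd a}. f d * \<nu> (a * b div d) = 0"
      proof
        fix d assume d: "d \<in> {d. d dvd a * b} - {d. d dvd a}"
        then have "d > 0" using pos by (auto intro: gr0I)
        have "\<not> d \<le> y"
        proof
          assume "d \<le> y"
          then have "coprime d b"
            using mem_smooth_primes_le[OF \<open>d > 0\<close>] b coprime_smooth_rough unfolding P_def by blast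
          then show False using d by (simp add: coprime_dvd_mult_left_iff)
        qed
        then show "f d * \<nu> (a * b div d) = 0" using f by simp
      qed
    qed (use pos in auto)
    also have "\<dots> = (\<Sum>d | d dvd a. \<nu> b * (f d * \<nu> (a div d)))"
    proof (rule sum.cong)
      fix d assume "d \<in> {d. d dvd a}"
      then obtain c where c: "a = d * c" by auto
      then have "c > 0" "d > 0" using pos by (auto intro: gr0I)
      moreover have "coprime c b" using coprime_smooth_rough[OF a b] c by simp
      ultimately show "f d * \<nu> (a * b div d) = \<nu> b * (f d * \<nu> (a div d))"
        using \<nu> pos c by (simp add: multiplicative_def mult.assoc)
    qed simp
    also have "\<dots> = \<nu> b * g a" by (simp add: g_def dirichlet_conv_def sum_distrib_left)
    finally show ?thesis .
  qed
  have "arith_supp g = (\<Union>a\<in>{a \<in> smooth P. g a \<noteq> 0}. (*) a ` T)"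
  proof (intro equalityI subsetI)
    fix n assume n: "n \<in> arith_supp g"
    then obtain a b where ab: "n = a * b" "a \<in> smooth P" "b \<in> rough P"
      using smooth_rough_decomposition[OF P(2), where n = n] by (auto simp: arith_supp_def)
    then have "g a \<noteq> 0" "b \<in> T" using n g_eq[of a b] by (auto simp: T_def arith_supp_def rough_def)
    then show "n \<in> (\<Union>a\<in>{a \<in> smooth P. g a \<noteq> 0}. (*) a ` T)" using ab by blast
  next
    fix n assume "n \<in> (\<Union>a\<in>{a \<in> smooth P. g a \<noteq> 0}. (*) a ` T)"
    then obtain a b where "n = a * b" "a \<in> smooth P" "b \<in> T" "g a \<noteq> 0" by blast
    then show "n \<in> arith_supp g"
      using g_eq[of a b] by (auto simp: T_def arith_supp_def smooth_def)
  qed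
  moreover have "\<exists>\<gamma>. has_asymp_density (\<Union>a\<in>{a \<in> smooth P. g a \<noteq> 0}. (*) a ` T) \<gamma>"
    by (rule asymp_density_smooth_dilates[OF tr(2,3) _ tr(1)]) (auto simp: T_def)
  ultimately show ?thesis by (simp add: g_def)
qed

lemma asymp_density_conv_thin_support:
  assumes \<nu>: "multiplicative \<nu>" and \<delta>: "has_asymp_density (arith_supp \<nu>) \<delta>"
    and thin: "thin (arith_supp f)"
  shows "\<exists>\<gamma>. has_asymp_density (arith_supp (dirichlet_conv f \<nu>)) \<gamma>"
proof (rule asymp_density_exists_by_approximation)
  show "arith_supp f \<subseteq> {0<..}" by (auto simp: arith_supp_def)
  show "(\<lambda>d. 1 / real d) summable_on arith_supp f" using thin by (simp add: thin_def)
  fix k :: nat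
  let ?f = "\<lambda>d. if d \<le> k then f d else 0"
  show "\<exists>\<gamma>. has_asymp_density (arith_supp (dirichlet_conv ?f \<nu>)) \<gamma>"
    by (rule asymp_density_conv_finite_support[OF \<nu> \<delta>, of k]) simp
  fix n
  assume n: "n \<in> (arith_supp (dirichlet_conv f \<nu>) - arith_supp (dirichlet_conv ?f \<nu>)) \<union>
    (arith_supp (dirichlet_conv ?f \<nu>) - arith_supp (dirichlet_conv f \<nu>))"
  then have n': "n > 0" "dirichlet_conv f \<nu> n \<noteq> dirichlet_conv ?f \<nu> n"
    by (auto simp: arith_supp_def)
  \<comment> \<open>A convolution at \<open>n\<close> sees its first factor only at divisors of
    \<open>n\<close>, so a discrepancy produces a divisor where the truncation took effect.\<close>
  have "\<exists>d. d dvd n \<and> f d \<noteq> ?f d"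
  proof (rule ccontr)
    assume "\<nexists>d. d dvd n \<and> f d \<noteq> ?f d"
    then have "dirichlet_conv f \<nu> n = dirichlet_conv ?f \<nu> n"
      unfolding dirichlet_conv_def by (intro sum.cong) auto
    with n' show False by simp
  qed
  then obtain d where d: "d dvd n" "f d \<noteq> ?f d" by blast
  then have "d > 0" "d > k" "f d \<noteq> 0" using n'(1) by (auto intro: gr0I split: if_splits)
  then show "\<exists>d\<in>arith_supp f. d > k \<and> d dvd n" using d by (intro bexI[of _ d]) (auto simp: arith_supp_def)
qed

section \<open>Positivity of the density\<close>

lemma conv_eq_single_term:
  assumes "n > 0" "d0 dvd n" "\<And>d. d dvd n \<Longrightarrow> f d \<noteq> 0 \<Longrightarrow> d = d0"
  shows "dirichlet_conv f \<nu> n = f d0 * \<nu> (n div d0)"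
proof -
  have "dirichlet_conv f \<nu> n = (\<Sum>d\<in>{d0}. f d * \<nu> (n div d))"
    unfolding dirichlet_conv_def by (rule sum.mono_neutral_right) (use assms in auto)
  then show ?thesis by simp
qed

lemma asymp_density_conv_pos:
  assumes \<nu>: "multiplicative \<nu>" and \<delta>: "has_asymp_density (arith_supp \<nu>) \<delta>" "\<delta> > 0"
    and thin: "thin (arith_supp f)" and f: "\<exists>n>0. f n \<noteq> 0"
    and \<gamma>: "has_asymp_density (arith_supp (dirichlet_conv f \<nu>)) \<gamma>"
  shows "\<gamma> > 0"
proof -
  define F where "F = arith_supp f"
  define G where "G = arith_supp (dirichlet_conv f \<nu>)"
  have F: "(\<lambda>d. 1 / real d) summable_on F" "F \<subseteq> {0<..}"
    using thin by (auto simp: thin_def F_def arith_supp_def)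
  define \<tau> where "\<tau> k = (\<Sum>\<^sub>\<infinity>d\<in>{d \<in> F. d > k}. 1 / real d)" for k
  have \<tau>: "\<tau> \<longlonglongrightarrow> 0" unfolding \<tau>_def by (rule infsum_tail_tendsto_0[OF F(1)])
  \<comment> \<open>Minimality ensures that the only element of \<open>F\<close> dividing
    \<open>d0\<close> is \<open>d0\<close> itself.\<close>
  define d0 where "d0 = (LEAST d. d \<in> F)"
  have "\<exists>d. d \<in> F" using f by (auto simp: F_def arith_supp_def)
  then have d0F: "d0 \<in> F" unfolding d0_def by (rule LeastI_ex)
  have d0_le: "d0 \<le> d" if "d \<in> F" for d unfolding d0_def using that by (rule Least_le)
  have d0: "d0 > 0" "f d0 \<noteq> 0" using d0F by (auto simp: F_def arith_supp_def)
  have "\<delta> / real d0 > 0" using \<delta>(2) d0 by simp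
  then have "\<forall>\<^sub>F y in sequentially. \<tau> y < \<delta> / real d0" by (rule order_tendstoD(2)[OF \<tau>])
  then have "\<forall>\<^sub>F y in sequentially. \<tau> y < \<delta> / real d0 \<and> d0 \<le> y"
    using eventually_ge_at_top[of d0] by eventually_elim auto
  \<comment> \<open>With this \<open>y\<close> the exceptions, of density at most
    \<open>r * \<tau> y\<close>, stay strictly below \<open>\<delta> * r / d0\<close>, a lower bound
    for the density of the dilate of \<open>T\<close>.\<close>
  then obtain y where y: "\<tau> y < \<delta> / real d0" "d0 \<le> y"
    using eventually_happens'[OF sequentially_bot] by blast
  define P where "P = {p::nat. prime p \<and> p \<le> y}"
  define T where "T = arith_supp \<nu> \<inter> rough P"
  have P: "finite P" "\<And>p. p \<in> P \<Longrightarrow> prime p" by (auto simp: P_def)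
  obtain t r where tr: "has_asymp_density T t" "has_asymp_density (rough P) r" "r > 0" "\<delta> * r \<le> t"
    using asymp_density_rough[OF P multiplicative_set_arith_supp[OF \<nu>] \<delta>(1)] unfolding T_def by blast
  \<comment> \<open>Write \<open>n = d0 * b\<close>. Divisors of \<open>n\<close> in
    \<open>F\<close> up to \<open>y\<close> are smooth, hence coprime to \<open>b\<close>; they
    divide \<open>d0\<close> and so equal it, which leaves a single term of the convolution.\<close>
  have good: "n \<in> G \<or> (\<exists>d\<in>F. d > y \<and> d dvd n)" if n: "n \<in> (*) d0 ` T" for n
  proof (rule disjCI)
    assume no: "\<not> (\<exists>d\<in>F. d > y \<and> d dvd n)"
    obtain b where b: "n = d0 * b" "b \<in> rough P" "\<nu> b \<noteq> 0" "b > 0"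
      using n by (auto simp: T_def arith_supp_def)
    have "dirichlet_conv f \<nu> n = f d0 * \<nu> (n div d0)"
    proof (rule conv_eq_single_term)
      fix d assume d: "d dvd n" "f d \<noteq> 0"
      then have "d > 0" using b d0 by (auto intro: gr0I)
      then have "d \<in> F" using d by (simp add: F_def arith_supp_def)
      then have "d \<le> y" using no d by (auto simp: not_le[symmetric])
      then have "coprime d b"
        using mem_smooth_primes_le[OF \<open>d > 0\<close>] b coprime_smooth_rough unfolding P_def by blast
      then have "d dvd d0" using d b by (simp add: coprime_dvd_mult_left_iff)
      then show "d = d0" using d0_le[OF \<open>d \<in> F\<close>] d0 dvd_imp_le by (meson le_antisym)
    qed (use b d0 in auto)
    then show "n \<in> G" using b d0 by (simp add: G_def arith_supp_def)
  qed
  \<comment> \<open>\<open>Z\<close> splits the exceptions. The finitely many \<open>d\<close>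
    between \<open>y\<close> and \<open>Z\<close> have their multiples counted inside dilates of
    \<open>rough P\<close>, which gains the factor \<open>r\<close>; those beyond \<open>Z\<close>
    get the cruder bound \<open>\<tau> Z\<close> without it, removed later by letting
    \<open>Z\<close> grow.\<close>
  have bound: "t / real d0 \<le> \<gamma> + r * \<tau> y + \<tau> Z" for Z
  proof -
    define H where "H = {d \<in> F. y < d \<and> d \<le> Z}"
    have H: "finite H" "H \<subseteq> F" by (auto simp: H_def)
    have pos: "lcm d d0 > 0" if "d \<in> H" for d
      using that H F d0 by (auto intro: lcm_pos_nat)
    define C where "C = {n. \<exists>d\<in>{d \<in> F. d > Z}. d dvd n}"
    have sub: "(*) d0 ` T \<subseteq> (G \<union> (\<Union>d\<in>H. (*) (lcm d d0) ` rough P)) \<union> C"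
    proof
      fix n assume n: "n \<in> (*) d0 ` T"
      show "n \<in> (G \<union> (\<Union>d\<in>H. (*) (lcm d d0) ` rough P)) \<union> C"
      proof (rule ccontr)
        assume no: "n \<notin> (G \<union> (\<Union>d\<in>H. (*) (lcm d d0) ` rough P)) \<union> C"
        with good[OF n] obtain d where d: "d \<in> F" "d > y" "d dvd n" by blast
        then have "\<not> Z < d" using no by (auto simp: C_def)
        then have "d \<in> H" using d by (simp add: H_def)
        obtain b where b: "n = d0 * b" "b \<in> rough P" using n by (auto simp: T_def)
        \<comment> \<open>The quotient of \<open>n\<close> by \<open>lcm d d0\<close> divides
          \<open>b\<close>, the quotient by \<open>d0\<close>, and is therefore rough as
          well.\<close>
        have "lcm d d0 dvd n" using d b by (simp add: lcm_least)
        then obtain c where c: "n = lcm d d0 * c" by (rule dvdE)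
        have "d0 dvd lcm d d0" by simp
        then obtain e where "lcm d d0 = d0 * e" by (rule dvdE)
        then have "b = e * c" using b c d0 by (simp add: mult.assoc)
        then have "c \<in> rough P" using b by (auto simp: rough_def)
        then show False using no c \<open>d \<in> H\<close> by blast
      qed
    qed
    define u where "u x = count_upto G x + (\<Sum>d\<in>H. count_upto ((*) (lcm d d0) ` rough P) x) + \<tau> Z * x" for x
    have "t / real d0 \<le> \<gamma> + (\<Sum>d\<in>H. r / real (lcm d d0)) + \<tau> Z"
    proof (rule has_asymp_density_le)
      show "has_asymp_density ((*) d0 ` T) (t / real d0)"
        by (rule has_asymp_density_dilate[OF d0(1) tr(1)])
      have "((\<lambda>x. count_upto G x / x + (\<Sum>d\<in>H. count_upto ((*) (lcm d d0) ` rough P) x / x) + \<tau> Z)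
          \<longlongrightarrow> \<gamma> + (\<Sum>d\<in>H. r / real (lcm d d0)) + \<tau> Z) at_top"
        using \<gamma> has_asymp_density_dilate[OF pos tr(2)]
        by (intro tendsto_add tendsto_sum tendsto_const) (auto simp: has_asymp_density_iff G_def)
      then show "((\<lambda>x. u x / x) \<longlongrightarrow> \<gamma> + (\<Sum>d\<in>H. r / real (lcm d d0)) + \<tau> Z) at_top"
      proof (rule Lim_transform_eventually)
        show "\<forall>\<^sub>F x in at_top. count_upto G x / x
            + (\<Sum>d\<in>H. count_upto ((*) (lcm d d0) ` rough P) x / x) + \<tau> Z = u x / x"
          using eventually_gt_at_top[of 0]
          by eventually_elim (simp add: u_def add_divide_distrib sum_divide_distrib)
      qed
      fix x :: real assume x: "x > 0"
      have "count_upto C x \<le> \<tau> Z * x"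
        unfolding \<tau>_def
      proof (rule count_upto_cover_le)
        show "\<exists>d\<in>{d \<in> F. d > Z}. d dvd n" if "n \<in> C" for n using that by (simp add: C_def)
      qed (use F x in \<open>auto intro: summable_on_subset_banach\<close>)
      moreover have "count_upto (\<Union>d\<in>H. (*) (lcm d d0) ` rough P) x
          \<le> (\<Sum>d\<in>H. count_upto ((*) (lcm d d0) ` rough P) x)"
        by (rule count_upto_UN_le[OF H(1)])
      ultimately show "count_upto ((*) d0 ` T) x \<le> u x"
        using count_upto_mono[OF sub, of x]
          count_upto_Un_le[of "G \<union> (\<Union>d\<in>H. (*) (lcm d d0) ` rough P)" C x]
          count_upto_Un_le[of G "\<Union>d\<in>H. (*) (lcm d d0) ` rough P" x]
        unfolding u_def by linarith
    qed
    moreover have "(\<Sum>d\<in>H. r / real (lcm d d0)) \<le> r * \<tau> y"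
    proof -
      have "(\<Sum>d\<in>H. r / real (lcm d d0)) \<le> (\<Sum>d\<in>H. r / real d)"
      proof (rule sum_mono)
        fix d assume d: "d \<in> H"
        then have "d \<le> lcm d d0" "d > 0" using pos[OF d] H F by (auto intro: dvd_imp_le)
        then show "r / real (lcm d d0) \<le> r / real d"
          using tr(3) by (intro divide_left_mono) auto
      qed
      also have "\<dots> = r * (\<Sum>d\<in>H. 1 / real d)" by (simp add: sum_distrib_left)
      also have "(\<Sum>d\<in>H. 1 / real d) \<le> \<tau> y"
        unfolding \<tau>_def
        by (rule finite_sum_le_infsum)
          (use F H in \<open>auto intro: summable_on_subset_banach simp: H_def\<close>)
      finally show ?thesis using tr(3) by simp
    qed
    ultimately show ?thesis by linarith
  qed
  \<comment> \<open>In the limit \<open>\<delta> * r / d0 \<le> t / d0 \<le> \<gamma> + r * \<tau> y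
    < \<gamma> + r * \<delta> / d0\<close>, which forces \<open>\<gamma> > 0\<close>.\<close>
  have "(\<lambda>Z. \<gamma> + r * \<tau> y + \<tau> Z) \<longlonglongrightarrow> \<gamma> + r * \<tau> y + 0" using \<tau> by (intro tendsto_intros)
  then have "t / real d0 \<le> \<gamma> + r * \<tau> y + 0"
    by (rule tendsto_lowerbound) (use bound in auto)
  moreover have "\<delta> * r / real d0 \<le> t / real d0" using tr(4) by (simp add: divide_right_mono)
  moreover have "r * \<tau> y < r * (\<delta> / real d0)" using y(1) tr(3) by (rule mult_strict_left_mono)
  ultimately show ?thesis by (simp add: mult.commute)
qed

theorem theorem1p2:
  fixes \<nu> f g :: "nat \<Rightarrow> complex"
  assumes "multiplicative \<nu>"
    and "has_positive_asymp_density (arith_supp \<nu>)"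
    and "\<And>n. n > 0 \<Longrightarrow> g n = dirichlet_conv f \<nu> n"
    and "\<exists>n>0. f n \<noteq> 0"
    and "thin (arith_supp f)"
  shows "has_positive_asymp_density (arith_supp g)"
proof -
  obtain \<delta> where \<delta>: "\<delta> > 0" "has_asymp_density (arith_supp \<nu>) \<delta>"
    using assms(2) unfolding has_positive_asymp_density_def by blast
  obtain \<gamma> where \<gamma>: "has_asymp_density (arith_supp (dirichlet_conv f \<nu>)) \<gamma>"
    using asymp_density_conv_thin_support[OF assms(1) \<delta>(2) assms(5)] by blast
  have "\<gamma> > 0"
    by (rule asymp_density_conv_pos[OF assms(1) \<delta>(2,1) assms(5,4) \<gamma>])
  moreover have "arith_supp g = arith_supp (dirichlet_conv f \<nu>)"
    using assms(3) by (auto simp: arith_supp_def)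
  ultimately show ?thesis using \<gamma> unfolding has_positive_asymp_density_def by auto
qed

end
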